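(* Let $G$ be a finite simple triangle-free graph with minimum degree $\delta \ge 3$. Then $\delta + 1 \le Z(G)$.
   Context: Zero forcing process on a graph $G=(V,E)$: start with an initial set $S\subseteq V$ of colored vertices. A colored vertex $v$ forces an uncolored neighbor $w$ (making $w$ colored) if $w$ is the only uncolored neighbor of $v$; forces are applied repeatedly. $S$ is a zero forcing set if eventually every vertex becomes colored. The zero forcing number $Z(G)$ is the minimum size of a zero forcing set. Triangle-free means $G$ contains no cycle of length 3. *)

theory Defs
  imports "Graph_Theory.Digraph" "Graph_Theory.Arc_Walk"
begin

text \<open>
  A finite simple graph is rendered by the library locale \<^locale>\<open>graph\<close>: a finite, symmetric,
  loop-free digraph without parallel arcs. An undirected edge is thus a pair of opposite arcs, so
  the degree of a vertex is its out-degree.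
\<close>

definition min_degree :: "('a, 'b) pre_digraph \<Rightarrow> nat" where
  "min_degree G = Min (out_degree G ` verts G)"

text \<open>
  The library's cycles also include the closed walks of length 2 that run back and forth along
  one edge; at length 3 they are exactly the cycles of the undirected graph.
\<close>

definition triangle_free :: "('a, 'b) pre_digraph \<Rightarrow> bool" where
  "triangle_free G \<longleftrightarrow> (\<nexists>p. pre_digraph.cycle G p \<and> length p = 3)"

definition forces :: "('a, 'b) pre_digraph \<Rightarrow> 'a set \<Rightarrow> 'a \<Rightarrow> 'a \<Rightarrow> bool" where
  "forces G C v w \<longleftrightarrow> v \<in> C \<and> {x. v \<rightarrow>\<^bsub>G\<^esub> x \<and> x \<notin> C} = {w}"

definition force_step :: "('a, 'b) pre_digraph \<Rightarrow> 'a set \<Rightarrow> 'a set \<Rightarrow> bool" where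
  "force_step G C C' \<longleftrightarrow> (\<exists>v w. forces G C v w \<and> C' = insert w C)"

definition zero_forcing_set :: "('a, 'b) pre_digraph \<Rightarrow> 'a set \<Rightarrow> bool" where
  "zero_forcing_set G S \<longleftrightarrow> S \<subseteq> verts G \<and> (force_step G)\<^sup>*\<^sup>* S (verts G)"

definition zero_forcing_number :: "('a, 'b) pre_digraph \<Rightarrow> nat" where
  "zero_forcing_number G = Min (card ` {S. zero_forcing_set G S})"

end

theory Submission
  imports Defs
begin

text \<open>
  Let \<open>\<delta>\<close> be the minimum degree. After a force performed by \<open>v\<close> the whole closed neighbourhood
  \<open>N[v]\<close> is coloured, and it has at least \<open>\<delta> + 1\<close> elements. So if the initial set has at most
  \<open>\<delta>\<close> vertices, then the first force leads to exactly \<open>N[v]\<close>. There the process is stuck: \<open>v\<close> has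
  no uncoloured neighbour, while by triangle-freeness every neighbour of \<open>v\<close> has all its
  other neighbours, at least \<open>\<delta> - 1 \<ge> 2\<close> many, outside \<open>N[v]\<close>.
\<close>

context graph
begin

text \<open>\<open>out_degree\<close> counts arcs; without parallel arcs, \<open>head G\<close> is
  injective on the arcs leaving \<open>v\<close>.\<close>

lemma card_neighbours_eq_out_degree: "card {x. v \<rightarrow> x} = out_degree G v"
proof -
  have "inj_on (head G) (out_arcs G v)"
    by (auto intro!: inj_onI no_multi_arcs simp: arc_to_ends_def)
  moreover have "head G ` out_arcs G v = {x. v \<rightarrow> x}"
    by (auto simp: arcs_ends_conv image_iff)
  ultimately show ?thesis
    by (metis card_image out_degree_def)
qed

lemma finite_neighbours: "finite {x. v \<rightarrow> x}"
  by (rule finite_subset[OF _ finite_verts]) auto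

lemma card_closed_neighbourhood: "card (insert v {x. v \<rightarrow> x}) = out_degree G v + 1"
proof -
  have "v \<notin> {x. v \<rightarrow> x}"
    using adj_not_same by blast
  then show ?thesis
    by (simp add: finite_neighbours card_neighbours_eq_out_degree)
qed

lemma min_degree_le_out_degree: "v \<in> verts G \<Longrightarrow> min_degree G \<le> out_degree G v"
  by (simp add: min_degree_def)

text \<open>Three arcs realising the adjacencies would form a closed walk. Loop-freeness makes its
  vertices distinct, so it would be a \<open>cycle\<close> of length 3.\<close>

lemma triangle_free_not_adj:
  assumes "triangle_free G" "u \<rightarrow> v" "v \<rightarrow> w"
  shows "\<not> w \<rightarrow> u"
proof
  assume "w \<rightarrow> u"
  obtain e where e: "e \<in> arcs G" "tail G e = u" "head G e = v"
    using assms(2) by (auto simp: arcs_ends_conv)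
  obtain f where f: "f \<in> arcs G" "tail G f = v" "head G f = w"
    using assms(3) by (auto simp: arcs_ends_conv)
  obtain g where g: "g \<in> arcs G" "tail G g = w" "head G g = u"
    using \<open>w \<rightarrow> u\<close> by (auto simp: arcs_ends_conv)
  have "u \<noteq> v" "v \<noteq> w" "w \<noteq> u"
    using assms(2,3) \<open>w \<rightarrow> u\<close> adj_not_same by auto
  moreover have "awalk u [e, f, g] u"
    using e f g by (auto simp: awalk_def)
  ultimately have "cycle [e, f, g]"
    using e f g by (auto simp: cycle_def awalk_verts_conv)
  then show False
    using assms(1) by (fastforce simp: triangle_free_def)
qed

text \<open>A common neighbour of \<open>u\<close> and \<open>v\<close> would close a triangle, so
  the only neighbour of \<open>u\<close> lost by leaving the closed neighbourhood of
  \<open>v\<close> is \<open>v\<close> itself.\<close>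

lemma card_neighbours_outside_closed_neighbourhood:
  assumes "triangle_free G" "v \<rightarrow> u"
  shows "card {x. u \<rightarrow> x \<and> x \<notin> insert v {x. v \<rightarrow> x}} = out_degree G u - 1"
proof -
  have "\<not> v \<rightarrow> x" if "u \<rightarrow> x" for x
    using triangle_free_not_adj[OF assms that] arcs_ends_symmetric[OF sym_arcs] by blast
  then have "{x. u \<rightarrow> x \<and> x \<notin> insert v {x. v \<rightarrow> x}} = {x. u \<rightarrow> x} - {v}"
    by auto
  moreover have "u \<rightarrow> v"
    using assms(2) arcs_ends_symmetric[OF sym_arcs] by blast
  ultimately show ?thesis
    by (simp add: card_neighbours_eq_out_degree)
qed

lemma no_force_step_from_closed_neighbourhood:
  assumes "triangle_free G" "3 \<le> min_degree G"
  shows "\<not> force_step G (insert v {x. v \<rightarrow> x}) C"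
proof
  assume "force_step G (insert v {x. v \<rightarrow> x}) C"
  then obtain u w where force: "forces G (insert v {x. v \<rightarrow> x}) u w"
    by (auto simp: force_step_def)
  \<comment> \<open>The forcing vertex is not \<open>v\<close>, which has no uncoloured neighbour
    left.\<close>
  then have "v \<rightarrow> u"
    by (auto simp: forces_def)
  have "{x. u \<rightarrow> x \<and> x \<notin> insert v {x. v \<rightarrow> x}} = {w}"
    using force unfolding forces_def by (rule conjunct2)
  then have "out_degree G u - 1 = 1"
    using card_neighbours_outside_closed_neighbourhood[OF assms(1) \<open>v \<rightarrow> u\<close>] by simp
  moreover have "u \<in> verts G"
    using \<open>v \<rightarrow> u\<close> by auto
  ultimately show False
    using min_degree_le_out_degree[of u] assms(2) by simp
qed

text \<open>This excludes that the process is already complete after the first force: some neighbour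
  of \<open>v\<close> still has neighbours outside.\<close>

lemma closed_neighbourhood_neq_verts:
  assumes "triangle_free G" "3 \<le> min_degree G"
  shows "insert v {x. v \<rightarrow> x} \<noteq> verts G"
proof
  assume eq: "insert v {x. v \<rightarrow> x} = verts G"
  then have "v \<in> verts G"
    by blast
  then have "3 \<le> card {x. v \<rightarrow> x}"
    using min_degree_le_out_degree[of v] assms(2) by (simp add: card_neighbours_eq_out_degree)
  then have "{x. v \<rightarrow> x} \<noteq> {}"
    by (metis card.empty not_numeral_le_zero)
  then obtain u where "v \<rightarrow> u"
    by blast
  have "{x. u \<rightarrow> x \<and> x \<notin> insert v {x. v \<rightarrow> x}} = {}"
    unfolding eq by auto
  then have "out_degree G u - 1 = 0"
    using card_neighbours_outside_closed_neighbourhood[OF assms(1) \<open>v \<rightarrow> u\<close>]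
    by (metis card.empty)
  moreover have "u \<in> verts G"
    using \<open>v \<rightarrow> u\<close> by auto
  ultimately show False
    using min_degree_le_out_degree[of u] assms(2) by simp
qed

lemma zero_forcing_set_card:
  assumes "triangle_free G" "3 \<le> min_degree G" "verts G \<noteq> {}" "zero_forcing_set G S"
  shows "min_degree G < card S"
proof (rule ccontr)
  assume "\<not> min_degree G < card S"
  then have small: "card S \<le> min_degree G"
    by simp
  have S: "S \<subseteq> verts G" "(force_step G)\<^sup>*\<^sup>* S (verts G)"
    using assms(4) by (auto simp: zero_forcing_set_def)
  have "finite S"
    using S(1) finite_verts by (rule finite_subset)
  have closed_le: "min_degree G < card (insert v {x. v \<rightarrow> x})" if "v \<in> verts G" for v
    using min_degree_le_out_degree[OF that] card_closed_neighbourhood[of v] by simp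
  \<comment> \<open>Ensures that at least one force takes place: \<open>S\<close> is smaller than
    any closed neighbourhood.\<close>
  have "S \<noteq> verts G"
  proof
    assume "S = verts G"
    obtain v where "v \<in> verts G"
      using assms(3) by blast
    then have "card (insert v {x. v \<rightarrow> x}) \<le> card S"
      using \<open>S = verts G\<close> by (intro card_mono) auto
    with closed_le[OF \<open>v \<in> verts G\<close>] small show False
      by simp
  qed
  with S(2) obtain C where "force_step G S C" and C: "(force_step G)\<^sup>*\<^sup>* C (verts G)"
    by (metis converse_rtranclpE)
  then obtain v w where force: "forces G S v w" and C_eq: "C = insert w S"
    by (auto simp: force_step_def)
  \<comment> \<open>\<open>w\<close> was the only uncoloured neighbour of \<open>v\<close>.\<close>
  have "insert v {x. v \<rightarrow> x} \<subseteq> C"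
    using force by (auto simp: forces_def C_eq)
  moreover have "card C \<le> card (insert v {x. v \<rightarrow> x})"
  proof -
    have "v \<in> verts G"
      using force S(1) by (auto simp: forces_def)
    moreover have "card C \<le> card S + 1"
      using \<open>finite S\<close> by (simp add: C_eq card_insert_if)
    ultimately show ?thesis
      using closed_le[of v] small by linarith
  qed
  \<comment> \<open>An inclusion of finite sets is an equality once the larger set has no more
    elements than the smaller one.\<close>
  ultimately have "insert v {x. v \<rightarrow> x} = C"
    using \<open>finite S\<close> by (intro card_seteq) (auto simp: C_eq)
  \<comment> \<open>From \<open>C\<close> the process either has ended or makes a further step; both
    are impossible.\<close>
  with C show False
    using no_force_step_from_closed_neighbourhood[OF assms(1,2)]
      closed_neighbourhood_neq_verts[OF assms(1,2)]
    by (metis converse_rtranclpE)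
qed

end

theorem theorem1:
  fixes G :: "('a, 'b) pre_digraph"
  assumes "graph G"
    and "verts G \<noteq> {}"
    and "triangle_free G"
    and "min_degree G \<ge> 3"
  shows "min_degree G + 1 \<le> zero_forcing_number G"
proof -
  interpret graph G by (rule assms(1))
  have "{S. zero_forcing_set G S} \<subseteq> Pow (verts G)"
    by (auto simp: zero_forcing_set_def)
  then have "finite {S. zero_forcing_set G S}"
    by (rule finite_subset) simp
  \<comment> \<open>A witness that \<open>Min\<close> is taken over a nonempty set, so that the
    minimum is attained.\<close>
  moreover have "zero_forcing_set G (verts G)"
    by (simp add: zero_forcing_set_def)
  ultimately have "zero_forcing_number G \<in> card ` {S. zero_forcing_set G S}"
    unfolding zero_forcing_number_def by (intro Min_in) auto
  then show ?thesis
    using zero_forcing_set_card[OF assms(3,4,2)] by (auto simp: Suc_le_eq)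
qed

end
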